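(* Let $G$ be a finite, simple, connected, undirected graph. (1) If $G$ contains no induced subgraph isomorphic to $K_4$ and no induced subgraph isomorphic to $P_5$, then for any finite, simple, connected, undirected graph $H$, $\gamma(G\square H)\geq \gamma(G)\gamma(H)$. (2) If, for some integer $r>4$, $G$ contains no induced subgraph isomorphic to $K_r$ and no induced subgraph isomorphic to $P_5$, then $\pi(G)\leq r-1$, where $\pi(G)$ denotes the power of $G$.
   Context: $P_n$ denotes the path on $n$ vertices and $K_n$ the complete graph on $n$ vertices. For a vertex $v$ of a graph $G$, $N[v]$ is the closed neighborhood of $v$. A set $S\subseteq V(G)$ dominates $G$ if every vertex of $G$ lies in $S$ or is adjacent to a vertex of $S$. The domination number $\gamma(G)$ is the minimum cardinality of a dominating set, and a $\gamma$-set is a dominating set of cardinality $\gamma(G)$. The Cartesian product $G\square H$ has vertex set $V(G)\times V(H)$, with $(u_1,v_1)$ and $(u_2,v_2)$ adjacent if and only if either $v_1=v_2$ and $u_1u_2\in E(G)$, or $u_1=u_2$ and $v_1v_2\in E(H)$. For a $\gamma$-set $D$ of $G$, the allegiance of $D$ with respect to $G$ is $a_G(D)=\max_{v\in V(G)}|D\cap N[v]|$. The power of $G$ is $\pi(G)=\min_D a_G(D)$, the minimum taken over all $\gamma$-sets $D$ of $G$. *)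

theory Defs
  imports "Graph_Theory.Graph_Theory"
begin

text \<open>
  A finite simple undirected graph is a \<^locale>\<open>pair_graph\<close>: a finite, loop-free, symmetric digraph
  without parallel arcs, where the edge \<open>uv\<close> is the pair of arcs \<open>(u, v)\<close>, \<open>(v, u)\<close>.
  Connectedness is \<^const>\<open>Digraph_Component.connected\<close>, which excludes the graph without vertices.
\<close>

definition complete_pgraph :: "nat \<Rightarrow> nat pair_pre_digraph" where
  "complete_pgraph n = \<lparr> pverts = {..<n}, parcs = {(i, j). i < n \<and> j < n \<and> i \<noteq> j} \<rparr>"

definition path_pgraph :: "nat \<Rightarrow> nat pair_pre_digraph" where
  "path_pgraph n = \<lparr> pverts = {..<n}, parcs = {(i, j). i < n \<and> j < n \<and> (j = Suc i \<or> i = Suc j)} \<rparr>"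

definition has_induced :: "'a pair_pre_digraph \<Rightarrow> 'b pair_pre_digraph \<Rightarrow> bool" where
  "has_induced G F \<longleftrightarrow>
     (\<exists>H. induced_subgraph H (with_proj G) \<and> digraph_iso H (with_proj F))"

definition cartesian_product ::
    "'a pair_pre_digraph \<Rightarrow> 'b pair_pre_digraph \<Rightarrow> ('a \<times> 'b) pair_pre_digraph" where
  "cartesian_product G H =
     \<lparr> pverts = pverts G \<times> pverts H,
       parcs = {((u1, v1), (u2, v2)).
         {(u1, v1), (u2, v2)} \<subseteq> pverts G \<times> pverts H \<and>
         (v1 = v2 \<and> (u1, u2) \<in> parcs G \<or> u1 = u2 \<and> (v1, v2) \<in> parcs H)} \<rparr>"

definition dominating_set :: "'a pair_pre_digraph \<Rightarrow> 'a set \<Rightarrow> bool" where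
  "dominating_set G S \<longleftrightarrow>
     S \<subseteq> pverts G \<and> (\<forall>v \<in> pverts G. v \<in> S \<or> (\<exists>u \<in> S. (v, u) \<in> parcs G))"

definition domination_number :: "'a pair_pre_digraph \<Rightarrow> nat" where
  "domination_number G = Min (card ` {S. dominating_set G S})"

definition gamma_set :: "'a pair_pre_digraph \<Rightarrow> 'a set \<Rightarrow> bool" where
  "gamma_set G D \<longleftrightarrow> dominating_set G D \<and> card D = domination_number G"

definition closed_neighborhood :: "'a pair_pre_digraph \<Rightarrow> 'a \<Rightarrow> 'a set" where
  "closed_neighborhood G v = insert v {u. (v, u) \<in> parcs G}"

definition allegiance :: "'a pair_pre_digraph \<Rightarrow> 'a set \<Rightarrow> nat" where
  "allegiance G D = Max ((\<lambda>v. card (D \<inter> closed_neighborhood G v)) ` pverts G)"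

definition domination_power :: "'a pair_pre_digraph \<Rightarrow> nat" where
  "domination_power G = Min (allegiance G ` {D. gamma_set G D})"

lemma complete_pgraph: "K\<^bsub>n\<^esub> (with_proj (complete_pgraph n))"
  unfolding complete_digraph_pair_def by (auto simp: complete_pgraph_def)

lemma pair_graph_path_pgraph: "pair_graph (path_pgraph n)"
proof -
  have "finite (parcs (path_pgraph n))"
    by (rule finite_subset[of _ "{..<n} \<times> {..<n}"]) (auto simp: path_pgraph_def)
  then show ?thesis
    by unfold_locales (auto simp: path_pgraph_def symmetric_def sym_def)
qed

lemma pair_graph_cartesian_product:
  assumes "pair_graph G" "pair_graph H"
  shows "pair_graph (cartesian_product G H)"
proof -
  interpret G: pair_graph G by fact
  interpret H: pair_graph H by fact
  have fin: "finite (pverts (cartesian_product G H))"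
    by (simp add: cartesian_product_def)
  have sub: "parcs (cartesian_product G H) \<subseteq>
      pverts (cartesian_product G H) \<times> pverts (cartesian_product G H)"
    by (auto simp: cartesian_product_def)
  have "finite (parcs (cartesian_product G H))"
    using finite_subset[OF sub] fin by simp
  moreover have "sym (parcs G)" "sym (parcs H)"
    using G.sym_arcs H.sym_arcs by (simp_all add: symmetric_def)
  then have "sym (parcs (cartesian_product G H))"
    unfolding sym_def cartesian_product_def by auto
  ultimately show ?thesis
    using fin sub G.no_loops' H.no_loops'
    by unfold_locales (auto simp: symmetric_def cartesian_product_def)
qed

end

theory Submission
  imports Defs
begin

text \<open>
  A minimum connected dominating set of a connected \<open>P\<^sub>5\<close>-free graph is a clique or has at most
  three vertices (Bacso and Tuza): its non-cut vertices have private neighbours outside the set, which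
  extend paths inside it. Without an induced \<open>K\<^sub>r\<close>, where \<open>r \<ge> 4\<close>, the domination number is thus at most
  \<open>r - 1\<close>. As the allegiance of a set is at most its size, this bounds the power; for \<open>r = 4\<close> it leaves
  Vizing's inequality for \<open>\<gamma>(G) \<le> 3\<close>.

  For \<open>\<gamma>(G) = 3\<close> let \<open>D\<close> dominate \<open>G \<box> H\<close>. Each \<open>h \<in> V(H)\<close> receives a set of at most \<open>|D\<^sub>h|\<close> labels out of
  three, where \<open>D\<^sub>h\<close> is the fibre of \<open>D\<close> over \<open>h\<close>, such that every closed neighbourhood of \<open>H\<close> sees all
  three labels. Then each label occurs on a dominating set of \<open>H\<close>, and \<open>3 \<gamma>(H) \<le> |D|\<close>. The labels are named
  after a dominating set \<open>{x, q, y}\<close> of \<open>G\<close>, where \<open>y\<close> is the only vertex not dominated by \<open>{x, q}\<close>;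
  it exists after adding edges to \<open>G\<close>. A one-element fibre \<open>{v}\<close> is labelled by a
  corner whose closed neighbourhood contains \<open>v\<close>, and a two-element fibre by two labels.
\<close>

section \<open>Sets of labels\<close>

datatype label = X | Q | Y

lemma UNIV_label: "UNIV = {X, Q, Y}"
  by (auto intro: label.exhaust)

lemma finite_label [simp]: "finite (S :: label set)"
  by (rule finite_subset[OF subset_UNIV]) (simp add: UNIV_label)

lemma card_UNIV_label [simp]: "card (UNIV :: label set) = 3"
  by (simp add: UNIV_label)

lemma all_label: "(\<forall>i. P i) \<longleftrightarrow> P X \<and> P Q \<and> P Y"
  by (metis label.exhaust)

lemma ex_label: "(\<exists>i. P i) \<longleftrightarrow> P X \<or> P Q \<or> P Y"
  by (metis label.exhaust)

lemma card_Compl_label [simp]: "card (- {j :: label}) = 2"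
  by (simp add: Compl_eq_Diff_UNIV card_Diff_subset)

lemma third_label: "j \<noteq> k \<Longrightarrow> \<exists>c. c \<noteq> j \<and> c \<noteq> k \<and> (\<forall>i. i = c \<or> i = j \<or> i = (k :: label))"
  by (cases j; cases k) (auto simp: all_label ex_label)

lemma ex_other_label: "\<exists>j. j \<noteq> (k :: label)"
  by (cases k) (auto simp: ex_label)

lemma other_label: "card S = 2 \<Longrightarrow> \<exists>j \<in> S. j \<noteq> (k :: label)"
  by (metis card_2_iff insertI1 insertI2)

section \<open>Labelling the fibres of a dominating set of the product\<close>

text \<open>
  \<open>M\<close> is non-adjacency of distinct vertices in a graph on \<open>V\<close>, \<open>B\<close> is adjacency in a graph on \<open>W\<close>, and
  \<open>D\<close> dominates their product. Assumption \<open>common\<close> says that no two vertices dominate the first graph,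
  \<open>unique\<close> that \<open>{x, q, y}\<close> does. Every \<open>z\<close> with \<open>M z v\<close> for all \<open>v\<close> in the fibre over \<open>h\<close> occurs in a fibre
  over a neighbour of \<open>h\<close>; this is the only way in which \<open>dominated\<close> is used.
\<close>

locale fibre_labelling =
  fixes V :: "'a set" and M :: "'a \<Rightarrow> 'a \<Rightarrow> bool" and x q y :: 'a
    and W :: "'b set" and B :: "'b \<Rightarrow> 'b \<Rightarrow> bool" and D :: "('a \<times> 'b) set"
  assumes finite_V: "finite V" and finite_W: "finite W" and D_sub: "D \<subseteq> V \<times> W"
    and M_sym: "M a b \<Longrightarrow> M b a" and M_irrefl: "\<not> M a a" and M_V: "M a b \<Longrightarrow> a \<in> V"
    and B_sym: "B h k \<Longrightarrow> B k h" and B_irrefl: "\<not> B h h" and B_W: "B h k \<Longrightarrow> h \<in> W"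
    and common: "a \<in> V \<Longrightarrow> b \<in> V \<Longrightarrow> \<exists>z. M z a \<and> M z b"
    and xy: "M x y" and qy: "M q y" and unique: "M z x \<Longrightarrow> M z q \<Longrightarrow> z = y"
    and dominated: "z \<in> V \<Longrightarrow> h \<in> W \<Longrightarrow>
      (\<exists>v. (v, h) \<in> D \<and> \<not> M z v) \<or> (\<exists>k. B h k \<and> (z, k) \<in> D)"
begin

definition fib :: "'b \<Rightarrow> 'a set" where
  "fib h = {v. (v, h) \<in> D}"

definition corner :: "label \<Rightarrow> 'a" where
  "corner i = (case i of X \<Rightarrow> x | Q \<Rightarrow> q | Y \<Rightarrow> y)"

lemma corner_simps [simp]: "corner X = x" "corner Q = q" "corner Y = y"
  by (simp_all add: corner_def)

text \<open>The labels open to a one-element fibre \<open>{v}\<close>. A corner is tied to its own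
  label, even if it is adjacent to another corner, because this label is counted in advance.\<close>

definition lst :: "'a \<Rightarrow> label set" where
  "lst v = (if v \<in> range corner then {i. v = corner i} else {i. \<not> M v (corner i)})"

text \<open>
  A fibre \<open>{q}\<close> or \<open>{q, y}\<close> can only count on its neighbours for the label \<open>X\<close> through vertices \<open>v\<close> with
  \<open>M v q\<close> and \<open>M v y\<close>; a two-element fibre containing such a \<open>v\<close> has to keep the label \<open>X\<close>. The second
  clause is the mirror image under exchanging \<open>x\<close> and \<open>q\<close>.
\<close>

definition forced :: "'b \<Rightarrow> label \<Rightarrow> bool" where
  "forced h i \<longleftrightarrow>
     (i = X \<and> (\<exists>v \<in> fib h. M v q \<and> M v y) \<and> (\<exists>k. B h k \<and> q \<in> fib k \<and> fib k \<subseteq> {q, y})) \<or>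
     (i = Q \<and> (\<exists>v \<in> fib h. M v x \<and> M v y) \<and> (\<exists>k. B h k \<and> x \<in> fib k \<and> fib k \<subseteq> {x, y}))"

definition must :: "'b \<Rightarrow> label set" where
  "must h = {i. corner i \<in> fib h \<or> forced h i}"

text \<open>The sizes keep a nonempty fibre from carrying more labels than it has elements, so that
  the total is bounded by the size of \<open>D\<close>.\<close>

definition adm :: "'b \<Rightarrow> label set \<Rightarrow> bool" where
  "adm h S \<longleftrightarrow> S \<noteq> {} \<and>
     (\<forall>v. fib h = {v} \<longrightarrow> (\<exists>c \<in> lst v. S = {c})) \<and>
     (card (fib h) = 2 \<longrightarrow> card S = 2 \<and> must h \<subseteq> S) \<and>
     (card (fib h) \<ge> 3 \<longrightarrow> S = UNIV)"

text \<open>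
  In a partial labelling an empty label set means that the fibre is not labelled yet. Fibres containing
  \<open>corner i\<close> are counted as showing \<open>i\<close> in advance, since \<open>adm\<close> will force this label.
\<close>

definition beside :: "('b \<Rightarrow> label set) \<Rightarrow> 'b \<Rightarrow> label \<Rightarrow> bool" where
  "beside l h i \<longleftrightarrow> (\<exists>k. B h k \<and> (i \<in> l k \<or> corner i \<in> fib k))"

definition sees :: "('b \<Rightarrow> label set) \<Rightarrow> 'b \<Rightarrow> label \<Rightarrow> bool" where
  "sees l h i \<longleftrightarrow> i \<in> l h \<or> beside l h i"

text \<open>
  The fibres that are not needy see all three labels as soon as every nonempty fibre carries an
  admissible label set, whichever these are.
\<close>

definition needy :: "'b \<Rightarrow> bool" where
  "needy h \<longleftrightarrow> (\<exists>v. fib h = {v} \<and> card (lst v) \<ge> 2) \<or>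
     (card (fib h) = 2 \<and> fib h \<noteq> {x, y} \<and> fib h \<noteq> {q, y})"

definition partial_labelling :: "('b \<Rightarrow> label set) \<Rightarrow> bool" where
  "partial_labelling l \<longleftrightarrow>
     (\<forall>h. l h \<noteq> {} \<longrightarrow> h \<in> W \<and> fib h \<noteq> {} \<and> adm h (l h) \<and> (needy h \<longrightarrow> (\<forall>i. sees l h i)))"

section \<open>Corners, lists and fibres\<close>

lemma M_V2: "M a b \<Longrightarrow> b \<in> V"
  using M_sym M_V by blast

lemma corner_V: "corner i \<in> V"
  using xy qy by (cases i) (auto dest: M_V M_V2)

lemma x_neq_q: "x \<noteq> q"
proof
  assume "x = q"
  obtain z where "M z x" "M z y"
    using common corner_V[of X] corner_V[of Y] by auto
  then show False
    using unique[of z] \<open>x = q\<close> M_irrefl by auto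
qed

lemma corners_distinct: "x \<noteq> y" "q \<noteq> y" "x \<noteq> q"
  using xy qy M_irrefl x_neq_q by auto

lemma inj_corner: "corner i = corner j \<longleftrightarrow> i = j"
  using corners_distinct by (cases i; cases j) auto

lemma lst_corner [simp]: "lst (corner i) = {i}"
  by (auto simp: lst_def inj_corner)

lemma no_common: "M z (corner i) \<Longrightarrow> M z (corner j) \<Longrightarrow> M z (corner k) \<Longrightarrow> i = j \<or> i = k \<or> j = k"
  using unique[of z] M_irrefl by (cases i; cases j; cases k) auto

lemma not_in_lst: "M z (corner i) \<Longrightarrow> i \<notin> lst z"
  using M_irrefl by (auto simp: lst_def inj_corner)

lemma lst_nonempty: "lst v \<noteq> {}"
proof (cases "v \<in> range corner")
  case False
  show ?thesis
  proof
    assume "lst v = {}"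
    then have "\<And>i. M v (corner i)"
      using False by (auto simp: lst_def)
    then show False
      using no_common[of v X Q Y] by blast
  qed
qed (auto simp: lst_def)

lemma not_lst_M: "card (lst v) \<ge> 2 \<Longrightarrow> i \<notin> lst v \<Longrightarrow> M v (corner i)"
  by (auto simp: lst_def inj_corner split: if_splits)

lemma finite_fib [simp]: "finite (fib h)"
  by (rule finite_subset[OF _ finite_V]) (use D_sub in \<open>auto simp: fib_def\<close>)

lemma fib_V: "v \<in> fib h \<Longrightarrow> v \<in> V"
  and fib_W: "v \<in> fib h \<Longrightarrow> h \<in> W"
  using D_sub by (auto simp: fib_def)

lemma vertical:
  assumes "h \<in> W" "z \<in> V" "\<And>v. v \<in> fib h \<Longrightarrow> M z v"
  obtains k where "B h k" "z \<in> fib k"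
  using dominated[of z h] assms by (auto simp: fib_def)

text \<open>A vertex missed by both \<open>a\<close> and \<open>b\<close> is not dominated inside
  the fibre, so it occurs over a neighbour of \<open>h\<close>.\<close>

lemma vertical_common:
  assumes "h \<in> W" "a \<in> V" "b \<in> V" "fib h \<subseteq> {a, b}"
  obtains z k where "B h k" "z \<in> fib k" "M z a" "M z b"
proof -
  obtain z where z: "M z a" "M z b"
    using common assms by blast
  with assms have "\<And>v. v \<in> fib h \<Longrightarrow> M z v" by blast
  with vertical[OF assms(1) M_V[OF z(1)]] z that show thesis by metis
qed

lemma card_fib_cases:
  obtains "fib h = {}" | v where "fib h = {v}" | v w where "fib h = {v, w}" "v \<noteq> w" "card (fib h) = 2"
    | "card (fib h) \<ge> 3"
proof -
  consider "card (fib h) = 0" | "card (fib h) = 1" | "card (fib h) = 2" | "card (fib h) \<ge> 3"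
    by linarith
  then show thesis
    using that by cases (auto simp: card_1_singleton_iff card_2_iff)
qed

lemma adm_corner: "adm h S \<Longrightarrow> corner i \<in> fib h \<Longrightarrow> i \<in> S"
  by (rule card_fib_cases[of h]) (auto simp: adm_def must_def)

text \<open>The label \<open>k\<close> is not in \<open>lst z\<close>, which settles the fibre
  \<open>{z}\<close>; larger fibres carry at least two labels.\<close>

lemma adm_other:
  assumes "adm h S" "z \<in> fib h" "M z (corner k)"
  obtains j where "j \<in> S" "j \<noteq> k"
proof (rule card_fib_cases[of h])
  fix v assume "fib h = {v}"
  then show thesis
    using assms not_in_lst[OF assms(3)] that by (auto simp: adm_def)
next
  assume "card (fib h) = 2"
  then show thesis
    using assms that other_label[of S k] by (auto simp: adm_def)
next
  assume "card (fib h) \<ge> 3"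
  then show thesis
    using assms that ex_other_label[of k] by (auto simp: adm_def)
qed (use assms in auto)

lemma adm_card: "adm h S \<Longrightarrow> fib h \<noteq> {} \<Longrightarrow> card S \<le> card (fib h)"
  by (rule card_fib_cases[of h]) (auto simp: adm_def)

lemma beside_corner: "h \<in> W \<Longrightarrow> (\<And>v. v \<in> fib h \<Longrightarrow> M v (corner i)) \<Longrightarrow> beside l h i"
  using vertical[of h "corner i"] corner_V M_sym unfolding beside_def by metis

lemma beside_mono: "beside l h i \<Longrightarrow> (\<And>k. l k \<subseteq> l' k) \<Longrightarrow> beside l' h i"
  unfolding beside_def by blast

lemma sees_mono: "sees l h i \<Longrightarrow> (\<And>k. l k \<subseteq> l' k) \<Longrightarrow> sees l' h i"
  unfolding sees_def beside_def by blast

section \<open>Extending partial labellings\<close>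

lemma extend_one:
  assumes l: "partial_labelling l" and h: "h \<in> W" "fib h \<noteq> {}" "l h = {}" and S: "adm h S"
    and sees: "needy h \<Longrightarrow> (\<And>i. i \<in> S \<or> beside l h i)"
  shows "partial_labelling (l(h := S))"
proof -
  have mono: "l k \<subseteq> (l(h := S)) k" for k
    using h by auto
  have "sees (l(h := S)) k i" if "k \<noteq> h" "l k \<noteq> {}" "needy k" for k i
    by (rule sees_mono[OF _ mono]) (use l that in \<open>auto simp: partial_labelling_def\<close>)
  moreover have "sees (l(h := S)) h i" if "needy h" for i
    using sees[OF that, of i] beside_mono[of l h i "l(h := S)"] mono unfolding sees_def by auto
  ultimately show ?thesis
    using l h S unfolding partial_labelling_def by (auto split: if_splits)
qed

lemma extend_two:
  assumes l: "partial_labelling l" and h: "h \<in> W" "fib h \<noteq> {}" "l h = {}"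
    and k: "k \<in> W" "fib k \<noteq> {}" "l k = {}" and S: "adm h S" and T: "adm k T" and "B h k"
    and sees: "\<And>i. i \<in> S \<union> T \<or> (beside l h i \<and> beside l k i)"
  shows "partial_labelling (l(h := S, k := T))"
proof -
  let ?l = "l(h := S, k := T)"
  have "h \<noteq> k" "B k h"
    using \<open>B h k\<close> B_irrefl B_sym by auto
  have mono: "l m \<subseteq> ?l m" for m
    using h k by auto
  have "sees ?l m i" if "m \<noteq> h" "m \<noteq> k" "l m \<noteq> {}" "needy m" for m i
    by (rule sees_mono[OF _ mono]) (use l that in \<open>auto simp: partial_labelling_def\<close>)
  moreover have "sees ?l h i" "sees ?l k i" for i
  proof -
    have "i \<in> ?l h \<or> i \<in> ?l k \<or> (beside ?l h i \<and> beside ?l k i)"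
      using sees[of i] beside_mono[of l _ i ?l] mono \<open>h \<noteq> k\<close> by auto
    then show "sees ?l h i" "sees ?l k i"
      using \<open>B h k\<close> \<open>B k h\<close> unfolding sees_def beside_def by blast+
  qed
  ultimately show ?thesis
    using l h k S T unfolding partial_labelling_def by (auto split: if_splits)
qed

lemma adm_pair: "card (fib h) = 2 \<Longrightarrow> j \<notin> must h \<Longrightarrow> adm h (- {j})"
  using ex_other_label[of j] by (auto simp: adm_def)

lemma adm_single: "fib h = {v} \<Longrightarrow> c \<in> lst v \<Longrightarrow> adm h {c}"
  by (auto simp: adm_def)

lemma adm_not_needy:
  assumes "fib h \<noteq> {}" "\<not> needy h"
  shows "\<exists>S. adm h S"
proof (rule card_fib_cases[of h])
  fix v assume "fib h = {v}"
  then show ?thesis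
    using lst_nonempty[of v] adm_single by blast
next
  assume two: "card (fib h) = 2"
  then have "fib h = {x, y} \<or> fib h = {q, y}"
    using assms by (auto simp: needy_def)
  then have "Q \<notin> must h \<or> X \<notin> must h"
    using corners_distinct M_irrefl by (auto simp: must_def forced_def)
  then show ?thesis
    using adm_pair[OF two] by blast
qed (use assms in \<open>auto simp: adm_def\<close>)

text \<open>A vertex forcing \<open>X\<close> or \<open>Q\<close> and also missed by that corner
  would be missed by all three corners, which \<open>unique\<close> and \<open>M_irrefl\<close>
  exclude.\<close>

lemma common_missed_not_must:
  assumes "\<And>v. v \<in> fib h \<Longrightarrow> M v (corner k)"
  shows "k \<notin> must h"
  using assms[of "corner k"] M_irrefl unique assms by (cases k) (auto simp: must_def forced_def)

lemma forced_pair: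
  assumes two: "card (fib h) = 2" and forced: "forced h i"
    and no: "\<And>k. \<exists>v \<in> fib h. \<not> M v (corner k)"
  obtains j where "j \<notin> must h" "beside l h j"
proof -
  consider v k where "v \<in> fib h" "M v q" "M v y" "B h k" "q \<in> fib k"
    | v k where "v \<in> fib h" "M v x" "M v y" "B h k" "x \<in> fib k"
    using forced by (auto simp: forced_def)
  then show thesis
  proof cases
    case 1
    obtain w where w: "fib h = {v, w}"
      using two \<open>v \<in> fib h\<close> by (auto simp: card_2_iff doubleton_eq_iff)
    have "\<not> M w q" "\<not> M w y"
      using no[of Q] no[of Y] 1 w by auto
    then have "Q \<notin> must h"
      using 1 w unique[of v] M_irrefl qy by (auto simp: must_def forced_def)
    moreover have "beside l h Q"
      using 1 by (auto simp: beside_def)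
    ultimately show thesis by (rule that)
  next
    case 2
    obtain w where w: "fib h = {v, w}"
      using two \<open>v \<in> fib h\<close> by (auto simp: card_2_iff doubleton_eq_iff)
    have "\<not> M w x" "\<not> M w y"
      using no[of X] no[of Y] 2 w by auto
    then have "X \<notin> must h"
      using 2 w unique[of v] M_irrefl xy by (auto simp: must_def forced_def)
    moreover have "beside l h X"
      using 2 by (auto simp: beside_def)
    ultimately show thesis by (rule that)
  qed
qed

text \<open>Two required labels would make the fibre a pair of corners. The pairs containing
  \<open>y\<close> are not needy, and \<open>{x, q}\<close> is missed by \<open>y\<close>
  altogether.\<close>

lemma must_unique:
  assumes "needy h" and two: "card (fib h) = 2" and no: "\<And>k. \<exists>v \<in> fib h. \<not> M v (corner k)"
    and unforced: "\<And>i. \<not> forced h i" and ij: "i \<in> must h" "j \<in> must h"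
  shows "i = j"
proof (rule ccontr)
  assume "i \<noteq> j"
  have "corner i \<in> fib h" "corner j \<in> fib h"
    using ij unforced by (auto simp: must_def)
  then have "fib h = {corner i, corner j}"
    using two \<open>i \<noteq> j\<close> inj_corner by (auto simp: card_2_iff)
  then show False
    using \<open>needy h\<close> \<open>i \<noteq> j\<close> no[of Y] xy qy corners_distinct
    by (cases i; cases j) (auto simp: needy_def doubleton_eq_iff)
qed

lemma avoid_unique:
  assumes "\<And>i j. i \<in> N \<Longrightarrow> j \<in> N \<Longrightarrow> i = (j :: label)"
  shows "\<exists>c. c \<noteq> k \<and> c \<notin> N"
proof -
  obtain c d where "c \<noteq> k" "d \<noteq> k" "c \<noteq> d"
    using third_label ex_other_label by metis
  with assms show ?thesis by blast
qed

lemma avoid_unique2: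
  assumes "\<And>i j. i \<in> N \<Longrightarrow> j \<in> N \<Longrightarrow> i = (j :: label)" "card L \<ge> 2"
  shows "\<exists>c \<in> L. c \<notin> N"
proof -
  obtain c where "c \<in> L"
    using assms(2) by fastforce
  have "\<exists>d \<in> L. d \<noteq> c"
  proof (rule ccontr)
    assume "\<not> ?thesis"
    then have "L \<subseteq> {c}" by auto
    then have "card L \<le> card {c}"
      by (rule card_mono[rotated]) simp
    with assms(2) show False by simp
  qed
  then obtain d where "d \<in> L" "d \<noteq> c" ..
  with assms(1) \<open>c \<in> L\<close> show ?thesis by blast
qed

text \<open>
  A needy fibre with two elements, or with one element whose list has two labels, has a neighbouring
  fibre such that it can be satisfied once the latter is labelled, and such that both can be satisfied
  simultaneously if neither is labelled. One-element fibres with a full list come last: the vertices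
  they see outside \<open>N[x]\<close>, \<open>N[q]\<close> and \<open>N[y]\<close> show at least two different labels.
\<close>

lemma extension:
  assumes l: "partial_labelling l" and h0: "h0 \<in> W" "fib h0 \<noteq> {}" "l h0 = {}"
  shows "\<exists>l'. partial_labelling l' \<and> {h. l h \<noteq> {}} \<subset> {h. l' h \<noteq> {}}"
proof (rule ccontr)
  assume no_ext: "\<not> ?thesis"
  define U where "U h \<longleftrightarrow> h \<in> W \<and> fib h \<noteq> {} \<and> l h = {}" for h
  have stuck1: False if "U h" "adm h S" "needy h \<Longrightarrow> (\<And>i. i \<in> S \<or> beside l h i)" for h S
  proof -
    have "partial_labelling (l(h := S))"
      using extend_one[OF l _ _ _ that(2,3)] that(1) by (auto simp: U_def)
    moreover have "{k. l k \<noteq> {}} \<subset> {k. (l(h := S)) k \<noteq> {}}"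
      using that by (auto simp: U_def adm_def)
    ultimately show False using no_ext by blast
  qed
  have stuck2: False if "U h" "U k" "adm h S" "adm k T" "B h k"
    "\<And>i. i \<in> S \<union> T \<or> (beside l h i \<and> beside l k i)" for h k S T
  proof -
    have "partial_labelling (l(h := S, k := T))"
      using extend_two[OF l _ _ _ _ _ _ that(3-6)] that(1,2) by (auto simp: U_def)
    moreover have "{m. l m \<noteq> {}} \<subset> {m. (l(h := S, k := T)) m \<noteq> {}}"
      using that by (auto simp: U_def adm_def)
    ultimately show False using no_ext by blast
  qed
  have lab: "adm k (l k)" if "\<not> U k" "z \<in> fib k" for k z
    using l that fib_W[of z k] by (auto simp: U_def partial_labelling_def)
  have needy: "needy h" if "U h" for h
    using adm_not_needy stuck1[OF that] that by (auto simp: U_def)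
  have no_common_missed: "\<exists>v \<in> fib h. \<not> M v (corner k)" if "U h" "card (fib h) = 2" for h k
  proof (rule ccontr)
    assume "\<not> ?thesis"
    then have *: "\<And>v. v \<in> fib h \<Longrightarrow> M v (corner k)" by blast
    have "beside l h k"
      using beside_corner * that(1) by (simp add: U_def)
    then show False
      using stuck1[OF that(1) adm_pair[OF that(2) common_missed_not_must]] * by auto
  qed
  have unforced: "\<not> forced h i" if "U h" "card (fib h) = 2" for h i
  proof
    assume "forced h i"
    from forced_pair[OF that(2) this no_common_missed[OF that]] obtain j
      where "j \<notin> must h" "beside l h j" by metis
    then show False
      using stuck1[OF that(1) adm_pair[OF that(2)]] by auto
  qed
  have must: "i = j" if "U h" "card (fib h) = 2" "i \<in> must h" "j \<in> must h" for h i j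
    using must_unique[OF needy[OF that(1)] that(2) no_common_missed[OF that(1,2)]
        unforced[OF that(1,2)]] that by blast
  have no_pair: False if Uh: "U h" and two: "card (fib h) = 2" for h
  proof -
    obtain v w where vw: "fib h = {v, w}"
      using two by (auto simp: card_2_iff)
    then have "v \<in> V" "w \<in> V" "h \<in> W" "fib h \<subseteq> {v, w}"
      using fib_V[of v h] fib_V[of w h] fib_W[of v h] by auto
    then obtain z k where k: "B h k" "z \<in> fib k" "M z v" "M z w"
      using vertical_common by metis
    show False
    proof (cases "U k")
      case True
      \<comment> \<open>Two pairs drop different labels; a one-element fibre over \<open>k\<close>
        shows the label dropped at \<open>h\<close>.\<close>
      have "\<exists>S T. adm h S \<and> adm k T \<and> S \<union> T = UNIV"
      proof (cases "card (fib k) = 2")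
        case two': True
        obtain i where i: "i \<notin> must h"
          using avoid_unique[of "must h" X] must[OF Uh two] by blast
        obtain j where j: "j \<noteq> i" "j \<notin> must k"
          using avoid_unique[of "must k" i] must[OF True two'] by blast
        have "- {i} \<union> - {j} = UNIV"
          using \<open>j \<noteq> i\<close> by auto
        with adm_pair[OF two i] adm_pair[OF two' j(2)] show ?thesis by blast
      next
        case False
        then obtain w where w: "fib k = {w}" "card (lst w) \<ge> 2"
          using needy[OF True] by (auto simp: needy_def)
        then obtain c where c: "c \<in> lst w" "c \<notin> must h"
          using avoid_unique2[of "must h" "lst w"] must[OF Uh two] by blast
        have "- {c} \<union> {c} = UNIV" by auto
        with adm_pair[OF two c(2)] adm_single[OF w(1) c(1)] show ?thesis by blast
      qed
      then show False
        using stuck2[OF Uh True _ _ k(1)] by blast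
    next
      case False
      then have adm: "adm k (l k)"
        using lab k by blast
      \<comment> \<open>If \<open>h\<close> has to keep the label \<open>i\<close>, then
        \<open>z\<close> is missed by \<open>corner i\<close>, and so \<open>k\<close> shows a label
        other than \<open>i\<close>.\<close>
      have "\<exists>j \<in> l k. j \<notin> must h"
      proof (cases "must h = {}")
        case True
        then show ?thesis using adm by (auto simp: adm_def)
      next
        case False
        then obtain i where i: "i \<in> must h" by blast
        then have "corner i \<in> fib h"
          using unforced[OF Uh two] by (auto simp: must_def)
        then have "M z (corner i)"
          using k vw by auto
        then obtain j where "j \<in> l k" "j \<noteq> i"
          using adm_other[OF adm k(2)] by blast
        then show ?thesis
          using must[OF Uh two i] by blast
      qed
      then obtain j where "j \<in> l k" "j \<notin> must h" ..
      then show False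
        using stuck1[OF Uh adm_pair[OF two]] k(1) by (auto simp: beside_def)
    qed
  qed
  have single: "\<exists>v. fib h = {v} \<and> card (lst v) \<ge> 2" if "U h" for h
    using needy[OF that] no_pair[OF that] by (auto simp: needy_def)
  have no_two: False if Uh: "U h" and v: "fib h = {v}" "k \<notin> lst v" for h v k
  proof -
    have two: "card (lst v) \<ge> 2"
      using single[OF Uh] v by auto
    have "lst v \<subseteq> - {k}" "card (- {k}) \<le> card (lst v)"
      using v two by auto
    then have lst: "lst v = - {k}"
      using card_seteq by (metis finite_label)
    have Mv: "M v (corner k)"
      by (rule not_lst_M) fact+
    have ss: "beside l g k" if "U g" "fib g = {u}" "M u (corner k)" for g u
      using beside_corner[of g k l] that by (auto simp: U_def)
    have "h \<in> W" "fib h \<subseteq> {v, corner k}"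
      using Uh v by (auto simp: U_def)
    \<comment> \<open>As \<open>z\<close> is missed by \<open>corner k\<close> too, its list omits
      \<open>k\<close>, which is present beside \<open>h\<close> anyway. So \<open>g\<close> shows,
      or can be given, one of the two other labels.\<close>
    then obtain z g where g: "B h g" "z \<in> fib g" "M z v" "M z (corner k)"
      using vertical_common[OF _ M_V[OF Mv] corner_V] by metis
    show False
    proof (cases "U g")
      case True
      then have z: "fib g = {z}" "card (lst z) \<ge> 2"
        using single[OF True] g by auto
      have "lst z \<subseteq> - {k}" "card (- {k}) \<le> card (lst z)"
        using z not_in_lst[OF g(4)] by auto
      then have lst': "lst z = - {k}"
        using card_seteq by (metis finite_label)
      obtain c where "c \<noteq> k"
        using ex_other_label by blast
      then obtain d where d: "d \<noteq> c" "d \<noteq> k" "\<And>i. i = d \<or> i = c \<or> i = k"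
        using third_label[OF \<open>c \<noteq> k\<close>] by blast
      have "adm h {c}" "adm g {d}"
        using adm_single v z lst lst' d \<open>c \<noteq> k\<close> by auto
      moreover have "i \<in> {c} \<union> {d} \<or> (beside l h i \<and> beside l g i)" for i
        using d(3)[of i] ss[OF Uh v(1) Mv] ss[OF True z(1) g(4)] by auto
      ultimately show False
        using stuck2[OF Uh True _ _ g(1)] by blast
    next
      case False
      then obtain j where j: "j \<in> l g" "j \<noteq> k"
        using adm_other[OF lab[OF False g(2)] g(2,4)] by blast
      then obtain c where c: "c \<noteq> j" "c \<noteq> k" "\<And>i. i = c \<or> i = j \<or> i = k"
        using third_label[OF j(2)] by blast
      have "adm h {c}"
        using adm_single v lst c by auto
      moreover have "i \<in> {c} \<or> beside l h i" for i
        using c(3)[of i] ss[OF Uh v(1) Mv] j(1) g(1) by (auto simp: beside_def)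
      ultimately show False
        using stuck1[OF Uh] by blast
    qed
  qed
  have "U h0"
    using h0 by (simp add: U_def)
  then obtain v where v: "fib h0 = {v}"
    using single by blast
  have full: "lst v = UNIV"
    using no_two[OF \<open>U h0\<close> v] by blast
  \<comment> \<open>Used twice, this gives two distinct labels beside \<open>h0\<close>; the full
    list supplies the third.\<close>
  have "\<exists>j. j \<noteq> k \<and> beside l h0 j" for k
  proof -
    have "v \<in> V" "fib h0 \<subseteq> {v, corner k}"
      using v fib_V[of v h0] by auto
    then obtain z g where g: "B h0 g" "z \<in> fib g" "M z v" "M z (corner k)"
      using vertical_common[OF h0(1) _ corner_V] by metis
    have "\<not> U g"
    proof
      assume "U g"
      then have "fib g = {z}"
        using single[OF \<open>U g\<close>] g by auto
      then show False
        using no_two[OF \<open>U g\<close>] not_in_lst[OF g(4)] by blast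
    qed
    then show ?thesis
      using adm_other[OF lab g(2,4)] g(1,2) by (metis beside_def)
  qed
  then obtain i j where ij: "beside l h0 i" "beside l h0 j" "i \<noteq> j"
    by metis
  then obtain c where "\<And>m. m = c \<or> m = i \<or> m = j"
    using third_label[OF ij(3)] by blast
  then show False
    using stuck1[OF \<open>U h0\<close> adm_single[OF v, of c]] full ij by (metis UNIV_I singletonI)
qed

section \<open>Complete labellings\<close>

text \<open>By \<open>extension\<close>, a partial labelling with the most labelled fibres is
  complete.\<close>

lemma complete_labelling:
  obtains l where "partial_labelling l" "\<And>h. h \<in> W \<Longrightarrow> fib h \<noteq> {} \<Longrightarrow> l h \<noteq> {}"
proof -
  let ?c = "\<lambda>l. card {h. l h \<noteq> ({} :: label set)}"
  have fin: "finite {h. l h \<noteq> {}}" and bound: "?c l \<le> card W" if "partial_labelling l" for l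
  proof -
    have "{h. l h \<noteq> {}} \<subseteq> W"
      using that by (auto simp: partial_labelling_def)
    then show "finite {h. l h \<noteq> {}}" "?c l \<le> card W"
      using finite_W finite_subset card_mono by blast+
  qed
  have "partial_labelling (\<lambda>_. {})"
    by (simp add: partial_labelling_def)
  then obtain l where l: "partial_labelling l" "\<And>l'. partial_labelling l' \<Longrightarrow> ?c l' \<le> ?c l"
    using ex_has_greatest_nat[of partial_labelling _ ?c] bound by (metis le_imp_less_Suc)
  have "l h \<noteq> {}" if "h \<in> W" "fib h \<noteq> {}" for h
  proof
    assume "l h = {}"
    with extension[OF l(1) that] obtain l' where
      l': "partial_labelling l'" "{h. l h \<noteq> {}} \<subset> {h. l' h \<noteq> {}}" by blast
    then have "?c l < ?c l'"
      by (intro psubset_card_mono fin)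
    with l(2)[OF l'(1)] show False by simp
  qed
  with l(1) show thesis by (rule that)
qed

text \<open>A vertex \<open>z\<close> missed by \<open>a\<close> and \<open>y\<close> lies over a
  neighbour \<open>k\<close>. In a fibre \<open>{z}\<close> only \<open>i\<close> remains in
  \<open>lst z\<close>; in a two-element fibre \<open>forced\<close> preserves
  \<open>i\<close>.\<close>

lemma beside_forced:
  assumes adm: "\<And>k. fib k \<noteq> {} \<Longrightarrow> adm k (l k)"
    and h: "a \<in> fib h" "fib h \<subseteq> {a, y}"
    and ai: "a = x \<and> i = Q \<or> a = q \<and> i = X"
  shows "beside l h i"
proof -
  have "a \<in> V" "y \<in> V"
    using ai corner_V[of X] corner_V[of Q] corner_V[of Y] by auto
  then obtain z k where k: "B h k" "z \<in> fib k" "M z a" "M z y"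
    using vertical_common[OF fib_W[OF h(1)] _ _ h(2)] by metis
  have "i \<in> l k" if z: "z \<noteq> corner i"
  proof (rule card_fib_cases[of k])
    fix v assume v: "fib k = {v}"
    then obtain c where c: "l k = {c}" "c \<in> lst z"
      using adm[of k] k(2) by (auto simp: adm_def)
    have "c = i"
      using c(2) not_in_lst[of z X] not_in_lst[of z Q] not_in_lst[of z Y] k ai
      by (cases c) auto
    with c show ?thesis by simp
  next
    assume "card (fib k) = 2"
    moreover have "i \<in> must k"
      using k h ai B_sym[OF k(1)] by (auto simp: must_def forced_def)
    ultimately show ?thesis
      using adm[of k] k(2) by (auto simp: adm_def)
  next
    assume "card (fib k) \<ge> 3"
    then show ?thesis
      using adm[of k] k(2) by (auto simp: adm_def)
  qed (use k in simp)
  then show ?thesis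
    using k by (auto simp: beside_def)
qed

lemma sees_all:
  assumes l: "partial_labelling l" and full: "\<And>h. h \<in> W \<Longrightarrow> fib h \<noteq> {} \<Longrightarrow> l h \<noteq> {}" and h: "h \<in> W"
  shows "sees l h i"
proof -
  have adm: "adm k (l k)" if "fib k \<noteq> {}" for k
    using l full[of k] that fib_W by (auto simp: partial_labelling_def)
  show ?thesis
  proof (cases "fib h = {} \<or> needy h")
    case True
    moreover have "fib h \<noteq> {}" if "needy h"
      using that by (auto simp: needy_def)
    ultimately show ?thesis
      using l full[OF h] beside_corner[OF h, of i l] by (auto simp: partial_labelling_def sees_def)
  next
    case False
    then have "adm h (l h)"
      by (intro adm) simp
    show ?thesis
    proof (rule card_fib_cases[of h])
      fix v assume v: "fib h = {v}"
      then have "card (lst v) = 1"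
        using False lst_nonempty[of v] card_gt_0_iff[of "lst v"]
        by (simp add: needy_def)
      then obtain c where c: "lst v = {c}"
        by (auto simp: card_1_singleton_iff)
      then have lh: "l h = {c}"
        using \<open>adm h (l h)\<close> v by (auto simp: adm_def)
      show ?thesis
      proof (cases "v \<in> range corner")
        case True
        then have vc: "v = corner c"
          using c by auto
        \<comment> \<open>\<open>M\<close> relates \<open>y\<close> to \<open>x\<close> and
          \<open>q\<close>, which settles all cases but \<open>x\<close> against \<open>q\<close>;
          those need \<open>beside_forced\<close>.\<close>
        have "beside l h i" if "i \<noteq> c" "M (corner c) (corner i)"
          using beside_corner[OF h] that v vc by simp
        moreover have "beside l h Q" if "c = X"
          by (rule beside_forced[of l x]) (use adm v vc that in auto)
        moreover have "beside l h X" if "c = Q"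
          by (rule beside_forced[of l q]) (use adm v vc that in auto)
        ultimately show ?thesis
          using xy qy M_sym lh by (cases c; cases i) (auto simp: sees_def)
      next
        case False
        then have "M v (corner i)" if "i \<noteq> c"
          using c that by (auto simp: lst_def)
        then show ?thesis
          using beside_corner[OF h] v lh by (auto simp: sees_def)
      qed
    next
      assume two: "card (fib h) = 2"
      then have *: "fib h = {x, y} \<or> fib h = {q, y}"
        using False by (auto simp: needy_def)
      have "beside l h Q" if "fib h = {x, y}"
        by (rule beside_forced[of l x]) (use adm that in auto)
      moreover have "beside l h X" if "fib h = {q, y}"
        by (rule beside_forced[of l q]) (use adm that in auto)
      ultimately show ?thesis
        using * adm_corner[OF \<open>adm h (l h)\<close>, of i] by (cases i) (auto simp: sees_def)
    qed (use \<open>adm h (l h)\<close> False in \<open>auto simp: adm_def sees_def\<close>)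
  qed
qed

theorem three_dominating_sets:
  obtains L :: "label \<Rightarrow> 'b set" where "\<And>i. L i \<subseteq> W"
    "\<And>i h. h \<in> W \<Longrightarrow> h \<in> L i \<or> (\<exists>k \<in> L i. B h k)"
    "(\<Sum>i \<in> UNIV. card (L i)) \<le> card D"
proof -
  obtain l where l: "partial_labelling l" and full: "\<And>h. h \<in> W \<Longrightarrow> fib h \<noteq> {} \<Longrightarrow> l h \<noteq> {}"
    using complete_labelling by blast
  have adm: "adm k (l k)" if "fib k \<noteq> {}" for k
    using l full[of k] that fib_W by (auto simp: partial_labelling_def)
  define L where "L i = {h \<in> W. i \<in> l h}" for i
  show thesis
  proof (rule that[of L])
    show "h \<in> L i \<or> (\<exists>k \<in> L i. B h k)" if h: "h \<in> W" for i h
    proof -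
      \<comment> \<open>Labels that \<open>beside\<close> counts in advance are present once all
        nonempty fibres are labelled.\<close>
      have "i \<in> l k" if "corner i \<in> fib k" for k
        using adm_corner[OF adm that] that by blast
      then show ?thesis
        using sees_all[OF l full h, of i] h B_W B_sym
        unfolding sees_def beside_def L_def by blast
    qed
    have "(\<Sum>i \<in> UNIV. card (L i)) = (\<Sum>i \<in> UNIV. \<Sum>h \<in> W. if i \<in> l h then 1 else 0)"
      using finite_W by (simp add: L_def sum.If_cases Int_def)
    also have "\<dots> = (\<Sum>h \<in> W. \<Sum>i \<in> UNIV. if i \<in> l h then 1 else 0)"
      by (rule sum.swap)
    also have "\<dots> = (\<Sum>h \<in> W. card (l h))"
      by (simp add: sum.If_cases)
    also have "\<dots> \<le> (\<Sum>h \<in> W. card (fib h))"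
    proof (rule sum_mono)
      fix h
      show "card (l h) \<le> card (fib h)"
        using l adm_card[of h "l h"] by (cases "l h = {}") (auto simp: partial_labelling_def)
    qed
    also have "\<dots> = card (SIGMA h:W. fib h)"
      using finite_W by simp
    also have "\<dots> = card D"
      by (rule bij_betw_same_card[of prod.swap])
        (use D_sub in \<open>auto simp: bij_betw_def fib_def intro!: inj_onI image_eqI\<close>)
    finally show "(\<Sum>i \<in> UNIV. card (L i)) \<le> card D" .
  qed (auto simp: L_def)
qed

end

text \<open>
  Deleting pairs from \<open>M\<close> (adding edges to the first graph) keeps \<open>D\<close> dominating. When no pair can be
  deleted without making some \<open>{x, q}\<close> dominating, the deleted pair \<open>xy\<close> is the only obstruction, so that
  \<open>y\<close> is the unique vertex missed by both \<open>x\<close> and \<open>q\<close>.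
\<close>

lemma three_dominating_sets_of_fibration:
  fixes V :: "'a set" and M :: "'a \<Rightarrow> 'a \<Rightarrow> bool" and W :: "'b set" and B :: "'b \<Rightarrow> 'b \<Rightarrow> bool"
    and D :: "('a \<times> 'b) set"
  assumes "finite V" "V \<noteq> {}" "finite W" "D \<subseteq> V \<times> W"
    and B: "\<And>h k. B h k \<Longrightarrow> B k h" "\<And>h. \<not> B h h" "\<And>h k. B h k \<Longrightarrow> h \<in> W"
    and "\<And>a b. M a b \<Longrightarrow> M b a" "\<And>a. \<not> M a a" "\<And>a b. M a b \<Longrightarrow> a \<in> V"
    and "\<And>a b. a \<in> V \<Longrightarrow> b \<in> V \<Longrightarrow> \<exists>z. M z a \<and> M z b"
    and "\<And>z h. z \<in> V \<Longrightarrow> h \<in> W \<Longrightarrow>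
      (\<exists>v. (v, h) \<in> D \<and> \<not> M z v) \<or> (\<exists>k. B h k \<and> (z, k) \<in> D)"
  shows "\<exists>L :: label \<Rightarrow> 'b set. (\<forall>i. L i \<subseteq> W \<and> (\<forall>h \<in> W. h \<in> L i \<or> (\<exists>k \<in> L i. B h k))) \<and>
    (\<Sum>i \<in> UNIV. card (L i)) \<le> card D"
  using assms(8-12)
proof (induction "card {(a, b). M a b}" arbitrary: M rule: less_induct)
  case less
  note M_sym = less.prems(1) and M_irrefl = less.prems(2) and M_V = less.prems(3)
    and common = less.prems(4) and dom = less.prems(5)
  have fin: "finite {(a, b). M a b}"
    by (rule finite_subset[of _ "V \<times> V"]) (use \<open>finite V\<close> M_V M_sym in auto)
  obtain a b where ab: "M a b"
    using common \<open>V \<noteq> {}\<close> by blast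
  define M' where "M' s t \<longleftrightarrow> M s t \<and> {s, t} \<noteq> {a, b}" for s t
  show ?case
  proof (cases "\<forall>s \<in> V. \<forall>t \<in> V. \<exists>z. M' z s \<and> M' z t")
    case True
    have "card {(s, t). M' s t} < card {(s, t). M s t}"
      by (rule psubset_card_mono[OF fin]) (use ab in \<open>auto simp: M'_def\<close>)
    then show ?thesis
    proof (rule less.hyps)
      show "M' t s" if "M' s t" for s t
        using that M_sym[of s t] by (auto simp: M'_def insert_commute)
      show "\<exists>z. M' z s \<and> M' z t" if "s \<in> V" "t \<in> V" for s t
        using True that by blast
      show "(\<exists>v. (v, h) \<in> D \<and> \<not> M' z v) \<or> (\<exists>k. B h k \<and> (z, k) \<in> D)"
        if "z \<in> V" "h \<in> W" for z h
        using dom[OF that] by (auto simp: M'_def)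
    qed (use M_irrefl M_V in \<open>auto simp: M'_def\<close>)
  next
    case False
    then obtain s t where st: "s \<in> V" "t \<in> V" "\<And>z. M z s \<Longrightarrow> M z t \<Longrightarrow> {z, s} = {a, b} \<or> {z, t} = {a, b}"
      by (auto simp: M'_def)
    obtain x q y where y: "M y x" "M y q" and xab: "{y, x} = {a, b}"
      and one: "\<And>z. M z x \<Longrightarrow> M z q \<Longrightarrow> {z, x} = {a, b} \<or> {z, q} = {a, b}"
    proof -
      obtain z where z: "M z s" "M z t"
        using common st by blast
      then consider "{z, s} = {a, b}" | "{z, t} = {a, b}"
        using st by blast
      then show thesis
      proof cases
        case 1
        then show thesis
          using that[of z s t] z st(3) by metis
      next
        case 2
        then show thesis
          using that[of z t s] z st(3) by metis
      qed
    qed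
    \<comment> \<open>In either case \<open>z\<close> belongs to the deleted pair
      \<open>{x, y}\<close>, and it differs from \<open>x\<close>.\<close>
    have unique: "z = y" if z: "M z x" "M z q" for z
    proof -
      have "x \<noteq> y" "z \<noteq> x" "q \<noteq> y" "z \<noteq> q"
        using y z M_irrefl by auto
      then show "z = y"
        using one[OF z] xab by (auto simp: doubleton_eq_iff)
    qed
    have xy: "M x y" "M q y"
      using y M_sym by blast+
    interpret fibre_labelling V M x q y W B D
      by unfold_locales (fact assms(1,3,4) B less.prems xy unique)+
    show ?thesis
      using three_dominating_sets by metis
  qed
qed

section \<open>Vizing's inequality for domination number at most three\<close>

context pair_graph
begin

lemma parcs_sym: "(u, v) \<in> parcs G \<Longrightarrow> (v, u) \<in> parcs G"
  using sym_arcs by (auto simp: symmetric_def elim: symE)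

lemma finite_dominating_set: "dominating_set G S \<Longrightarrow> finite S"
  by (rule finite_subset[of S "pverts G"]) (auto simp: dominating_set_def)

lemma finite_dominating_sets: "finite {S. dominating_set G S}"
  by (rule finite_subset[of _ "Pow (pverts G)"]) (auto simp: dominating_set_def)

lemma domination_number_le: "dominating_set G S \<Longrightarrow> domination_number G \<le> card S"
  unfolding domination_number_def using finite_dominating_sets by (auto intro: Min_le)

lemma gamma_set_exists: "\<exists>D. gamma_set G D"
proof -
  have "dominating_set G (pverts G)"
    by (auto simp: dominating_set_def)
  then have "domination_number G \<in> card ` {S. dominating_set G S}"
    unfolding domination_number_def using finite_dominating_sets by (intro Min_in) auto
  then show ?thesis
    by (auto simp: gamma_set_def)
qed

end

text \<open>
  Adding \<open>3 - \<gamma>(G)\<close> isolated vertices to \<open>G\<close>, and a minimum dominating set of \<open>H\<close> over each of them, reduces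
  to domination number three.
\<close>

theorem vizing_domination_number_le_3:
  fixes G :: "'a pair_pre_digraph" and H :: "'b pair_pre_digraph"
  assumes G: "pair_graph G" and H: "pair_graph H" and "pverts G \<noteq> {}"
    and le3: "domination_number G \<le> 3"
  shows "domination_number G * domination_number H \<le> domination_number (cartesian_product G H)"
proof -
  interpret G: pair_graph G by fact
  interpret H: pair_graph H by fact
  interpret GH: pair_graph "cartesian_product G H"
    by (rule pair_graph_cartesian_product) fact+
  define n where "n = 3 - domination_number G"
  obtain D where D: "gamma_set (cartesian_product G H) D"
    using GH.gamma_set_exists by blast
  obtain S where S: "gamma_set H S"
    using H.gamma_set_exists by blast
  define V :: "('a + nat) set" where "V = Inl ` pverts G \<union> Inr ` {..<n}"
  define M :: "'a + nat \<Rightarrow> 'a + nat \<Rightarrow> bool" where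
    "M a b \<longleftrightarrow> a \<in> V \<and> b \<in> V \<and> a \<noteq> b \<and> (\<nexists>u v. a = Inl u \<and> b = Inl v \<and> (u, v) \<in> parcs G)" for a b
  define B where "B h k \<longleftrightarrow> (h, k) \<in> parcs H" for h k
  define D' where "D' = map_prod Inl id ` D \<union> (Inr ` {..<n}) \<times> S"
  have D_dom: "D \<subseteq> pverts G \<times> pverts H"
    "\<And>u h. u \<in> pverts G \<Longrightarrow> h \<in> pverts H \<Longrightarrow> (u, h) \<in> D \<or>
      (\<exists>v. (u, v) \<in> parcs G \<and> (v, h) \<in> D) \<or> (\<exists>k. (h, k) \<in> parcs H \<and> (u, k) \<in> D)"
  proof -
    have dom: "dominating_set (cartesian_product G H) D"
      using D by (simp add: gamma_set_def)
    then show "D \<subseteq> pverts G \<times> pverts H"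
      by (simp add: dominating_set_def cartesian_product_def)
    fix u h assume "u \<in> pverts G" "h \<in> pverts H"
    then have "(u, h) \<in> pverts (cartesian_product G H)"
      by (simp add: cartesian_product_def)
    with dom consider "(u, h) \<in> D"
      | v k where "(v, k) \<in> D" "((u, h), (v, k)) \<in> parcs (cartesian_product G H)"
      unfolding dominating_set_def by fast
    then show "(u, h) \<in> D \<or> (\<exists>v. (u, v) \<in> parcs G \<and> (v, h) \<in> D) \<or>
        (\<exists>k. (h, k) \<in> parcs H \<and> (u, k) \<in> D)"
      by cases (auto simp: cartesian_product_def)
  qed
  have S_dom: "S \<subseteq> pverts H" "\<And>h. h \<in> pverts H \<Longrightarrow> h \<in> S \<or> (\<exists>k \<in> S. (h, k) \<in> parcs H)"
    using S by (auto simp: gamma_set_def dominating_set_def)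
  have finD: "finite D"
    by (rule finite_subset[OF D_dom(1)]) simp
  have "\<exists>L :: label \<Rightarrow> 'b set. (\<forall>i. L i \<subseteq> pverts H \<and>
      (\<forall>h \<in> pverts H. h \<in> L i \<or> (\<exists>k \<in> L i. B h k))) \<and> (\<Sum>i \<in> UNIV. card (L i)) \<le> card D'"
  proof (rule three_dominating_sets_of_fibration[of V _ _ _ M])
    show "finite V" "V \<noteq> {}" "D' \<subseteq> V \<times> pverts H"
      using D_dom(1) S_dom(1) \<open>pverts G \<noteq> {}\<close> by (auto simp: V_def D'_def)
    show "M b a" if "M a b" for a b
      using that G.parcs_sym by (auto simp: M_def)
    show "B k h" if "B h k" for h k
      using that H.parcs_sym by (simp add: B_def)
    show "\<exists>z. M z a \<and> M z b" if ab: "a \<in> V" "b \<in> V" for a b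
    \<comment> \<open>Two vertices dominating \<open>V\<close> would comprise all \<open>n\<close>
      isolated vertices and a dominating set of \<open>G\<close>, at least three vertices in
      all.\<close>
    proof (rule ccontr)
      assume "\<not> ?thesis"
      then have no: "z \<in> {a, b} \<or> (\<exists>u v. z = Inl u \<and> Inl v \<in> {a, b} \<and> (u, v) \<in> parcs G)"
        if "z \<in> V" for z
        using that ab by (auto simp: M_def)
      define A where "A = Inl -` {a, b}"
      have "dominating_set G A"
        unfolding dominating_set_def
      proof (intro conjI ballI)
        show "A \<subseteq> pverts G"
          using ab by (auto simp: A_def V_def)
        show "u \<in> A \<or> (\<exists>v \<in> A. (u, v) \<in> parcs G)" if "u \<in> pverts G" for u
          using no[of "Inl u"] that by (auto simp: A_def V_def)
      qed
      then have "domination_number G \<le> card A"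
        by (rule G.domination_number_le)
      moreover have "finite A"
        unfolding A_def by (rule finite_vimageI) auto
      ultimately have "3 \<le> card (Inl ` A \<union> Inr ` {..<n} :: ('a + nat) set)"
        by (subst card_Un_disjoint) (auto simp: card_image n_def)
      also have "\<dots> \<le> card {a, b}"
        by (rule card_mono) (use no in \<open>auto simp: A_def V_def\<close>)
      also have "\<dots> \<le> 2"
        by (simp add: card_insert_if)
      finally show False by simp
    qed
    show "(\<exists>v. (v, h) \<in> D' \<and> \<not> M z v) \<or> (\<exists>k. B h k \<and> (z, k) \<in> D')"
      if "z \<in> V" "h \<in> pverts H" for z h
    proof (cases z)
      case (Inl u)
      then have "u \<in> pverts G"
        using that by (auto simp: V_def)
      from D_dom(2)[OF this that(2)] show ?thesis
        using Inl by (fastforce simp: D'_def M_def B_def image_iff)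
    next
      case (Inr j)
      then show ?thesis
        using S_dom(2)[OF that(2)] that(1) by (fastforce simp: D'_def M_def B_def V_def)
    qed
  qed (use H.no_loops' H.in_arcsD1 in \<open>auto simp: M_def B_def\<close>)
  then obtain L :: "label \<Rightarrow> 'b set" where L: "\<And>i. dominating_set H (L i)"
    "(\<Sum>i \<in> UNIV. card (L i)) \<le> card D'"
    by (auto simp: dominating_set_def B_def)
  have "3 * domination_number H = (\<Sum>i \<in> (UNIV :: label set). domination_number H)"
    by simp
  also have "\<dots> \<le> (\<Sum>i \<in> UNIV. card (L i))"
    by (intro sum_mono H.domination_number_le L)
  also have "\<dots> \<le> card D'"
    by (rule L)
  also have "\<dots> \<le> card (map_prod Inl id ` D :: (('a + nat) \<times> 'b) set) + card ((Inr ` {..<n} :: ('a + nat) set) \<times> S)"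
    unfolding D'_def by (rule card_Un_le)
  also have "\<dots> \<le> card D + n * card S"
    using card_image_le[OF finD, of "map_prod Inl id :: _ \<Rightarrow> ('a + nat) \<times> 'b"]
    by (simp add: card_cartesian_product card_image)
  also have "\<dots> = domination_number (cartesian_product G H) + n * domination_number H"
    using D S by (simp add: gamma_set_def)
  finally have "3 * domination_number H \<le> \<dots>" .
  \<comment> \<open>By \<open>le3\<close> the truncated subtraction defining \<open>n\<close> is
    exact, so the cost of the added vertices cancels.\<close>
  moreover have "3 * domination_number H = domination_number G * domination_number H + n * domination_number H"
    using le3 by (simp add: n_def flip: add_mult_distrib)
  ultimately show ?thesis by simp
qed

section \<open>Connected dominating sets of \<open>P\<^sub>5\<close>-free graphs\<close>

lemma has_inducedI:
  assumes "pair_graph G" and F: "pair_wf_digraph F"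
    and inj: "inj_on f (pverts F)" and sub: "f ` pverts F \<subseteq> pverts G"
    and arcs: "\<And>i j. i \<in> pverts F \<Longrightarrow> j \<in> pverts F \<Longrightarrow> (f i, f j) \<in> parcs G \<longleftrightarrow> (i, j) \<in> parcs F"
  shows "has_induced G F"
proof -
  interpret G: pair_graph G by fact
  interpret F: pair_wf_digraph F by fact
  define A where "A = f ` pverts F"
  define H where "H = \<lparr>pverts = A, parcs = parcs G \<inter> A \<times> A\<rparr>"
  define g where "g = the_inv_into (pverts F) f"
  have gf: "g (f i) = i" if "i \<in> pverts F" for i
    using inj that by (simp add: g_def the_inv_into_f_f)
  interpret H: pair_wf_digraph H
    by unfold_locales (auto simp: H_def)
  have "induced_subgraph (with_proj H) (with_proj G)"
  proof -
    have "pverts H \<subseteq> pverts G" "parcs H = {e \<in> parcs G. fst e \<in> pverts H \<and> snd e \<in> pverts H}"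
      using sub by (auto simp: H_def A_def)
    then show ?thesis
      using H.wf_digraph_axioms G.wf_digraph_axioms
      unfolding induced_subgraph_def subgraph_def compatible_def with_proj_simps by blast
  qed
  moreover have "digraph_iso (with_proj H) (with_proj F)"
    unfolding digraph_iso_def
  proof (intro exI conjI)
    let ?hom = "\<lparr>iso_verts = g, iso_arcs = map_prod g g, iso_head = snd, iso_tail = fst\<rparr>"
    have inj_g: "inj_on g A"
      using gf by (auto simp: A_def intro!: inj_onI)
    have "inj_on (map_prod g g) (parcs H)"
      by (rule inj_on_subset[OF map_prod_inj_on[OF inj_g inj_g]]) (auto simp: H_def)
    with inj_g show "pre_digraph.digraph_isomorphism (with_proj H) ?hom"
      using H.wf_digraph_axioms by (auto simp: pre_digraph.digraph_isomorphism_def H_def)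
    have "parcs F = map_prod g g ` parcs H"
    proof (intro equalityI subsetI)
      fix e assume "e \<in> parcs F"
      then obtain i j where e: "e = (i, j)" "i \<in> pverts F" "j \<in> pverts F" "(i, j) \<in> parcs F"
        using F.in_arcsD1 F.in_arcsD2 by (cases e) auto
      then have "(f i, f j) \<in> parcs H"
        using arcs by (auto simp: H_def A_def)
      then show "e \<in> map_prod g g ` parcs H"
        using e gf by (force intro: image_eqI[of _ _ "(f i, f j)"])
    qed (use arcs gf in \<open>auto simp: H_def A_def\<close>)
    moreover have "pverts F = g ` A"
      using gf by (force simp: A_def image_image)
    ultimately show "with_proj F = app_iso ?hom (with_proj H)"
      by (simp add: app_iso_def with_proj_def H_def)
  qed
  ultimately show ?thesis
    unfolding has_induced_def by blast
qed

lemma has_induced_complete: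
  assumes "pair_graph G" "A \<subseteq> pverts G" "card A = n"
    and clique: "\<And>u v. u \<in> A \<Longrightarrow> v \<in> A \<Longrightarrow> u \<noteq> v \<Longrightarrow> (u, v) \<in> parcs G"
  shows "has_induced G (complete_pgraph n)"
proof -
  interpret G: pair_graph G by fact
  have "finite A"
    by (rule finite_subset[OF assms(2)]) simp
  then obtain f where f: "bij_betw f {..<n} A"
    using ex_bij_betw_nat_finite[of A] assms(3) by (auto simp: atLeast0LessThan)
  have "pair_wf_digraph (complete_pgraph n)"
    by unfold_locales (auto simp: complete_pgraph_def)
  then show ?thesis
  proof (rule has_inducedI[OF assms(1), of _ f])
    fix i j assume "i \<in> pverts (complete_pgraph n)" "j \<in> pverts (complete_pgraph n)"
    then have "i < n" "j < n" "f i \<in> A" "f j \<in> A" "f i = f j \<longleftrightarrow> i = j"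
      using f by (auto simp: complete_pgraph_def bij_betw_def inj_on_def)
    then show "(f i, f j) \<in> parcs G \<longleftrightarrow> (i, j) \<in> parcs (complete_pgraph n)"
      using clique G.no_loops' by (auto simp: complete_pgraph_def)
  qed (use f assms(2) in \<open>auto simp: complete_pgraph_def bij_betw_def\<close>)
qed

text \<open>The listed arcs and non-arcs already force the five vertices to be distinct.\<close>

lemma has_induced_path5:
  assumes "pair_graph G"
    and "(a, b) \<in> parcs G" "(b, c) \<in> parcs G" "(c, d) \<in> parcs G" "(d, e) \<in> parcs G"
    and "(a, c) \<notin> parcs G" "(a, d) \<notin> parcs G" "(a, e) \<notin> parcs G"
    and "(b, d) \<notin> parcs G" "(b, e) \<notin> parcs G" "(c, e) \<notin> parcs G"
  shows "has_induced G (path_pgraph 5)"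
proof -
  interpret G: pair_graph G by fact
  let ?f = "\<lambda>i. [a, b, c, d, e] ! i"
  have five: "{..<5} = {0, 1, 2, 3, 4 :: nat}" by auto
  note sym = G.parcs_sym[OF assms(2)] G.parcs_sym[OF assms(3)] G.parcs_sym[OF assms(4)]
    G.parcs_sym[OF assms(5)]
  have nsym: "(c, a) \<notin> parcs G" "(d, a) \<notin> parcs G" "(e, a) \<notin> parcs G" "(d, b) \<notin> parcs G"
    "(e, b) \<notin> parcs G" "(e, c) \<notin> parcs G"
    using assms(6-) G.parcs_sym by blast+
  have distinct: "distinct [a, b, c, d, e]"
    using assms(2-) sym nsym G.no_loops' by auto
  interpret P: pair_graph "path_pgraph 5"
    by (rule pair_graph_path_pgraph)
  show ?thesis
  proof (rule has_inducedI[OF assms(1) P.pair_wf_digraph_axioms, of ?f])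
    show "inj_on ?f (pverts (path_pgraph 5))"
      using inj_on_nth[OF distinct] by (simp add: path_pgraph_def)
    show "?f ` pverts (path_pgraph 5) \<subseteq> pverts G"
      using assms(2-5) G.in_arcsD1 G.in_arcsD2 by (auto simp: path_pgraph_def five)
    show "(?f i, ?f j) \<in> parcs G \<longleftrightarrow> (i, j) \<in> parcs (path_pgraph 5)"
      if "i \<in> pverts (path_pgraph 5)" "j \<in> pverts (path_pgraph 5)" for i j
    proof -
      have "i \<in> {0, 1, 2, 3, 4}" "j \<in> {0, 1, 2, 3, 4}"
        using that by (auto simp: path_pgraph_def)
      moreover have "(u, u) \<notin> parcs G" for u
        using G.no_loops' by blast
      ultimately show ?thesis
        using assms(2-) sym nsym by (elim insertE emptyE) (simp_all add: path_pgraph_def)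
    qed
  qed
qed

section \<open>Connected vertex sets\<close>

context pair_graph
begin

text \<open>Connectedness of the subgraph induced on \<open>S\<close>, phrased by cuts to avoid
  walks confined to \<open>S\<close>.\<close>

definition conn :: "'a set \<Rightarrow> bool" where
  "conn S \<longleftrightarrow> S \<noteq> {} \<and> (\<forall>Z. Z \<subset> S \<longrightarrow> Z \<noteq> {} \<longrightarrow> (\<exists>u \<in> Z. \<exists>v \<in> S - Z. (u, v) \<in> parcs G))"

lemma conn_pverts:
  assumes "Digraph_Component.connected (with_proj G)"
  shows "conn (pverts G)"
  unfolding conn_def
proof (intro conjI allI impI)
  have sc: "strongly_connected (with_proj (mk_symmetric (with_proj G)))"
    using assms by (simp add: connected_def)
  then show "pverts G \<noteq> {}"
    by (simp add: strongly_connected_def)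
  fix Z assume Z: "Z \<subset> pverts G" "Z \<noteq> {}"
  then obtain u v where uv: "u \<in> Z" "v \<in> pverts G - Z" by blast
  have "u \<rightarrow>\<^sup>*\<^bsub>with_proj G\<^esub> v"
    using sc uv Z reachable_mk_symmetric_eq[OF sym_arcs] by (auto simp: strongly_connected_def)
  then have "(u, v) \<in> (parcs G)\<^sup>*"
    using reachable_rtranclI by fastforce
  then have "v \<in> Z \<or> (\<exists>u \<in> Z. \<exists>v \<in> pverts G - Z. (u, v) \<in> parcs G)"
    by (induction rule: rtrancl_induct) (use uv in_arcsD2 in auto)
  with uv show "\<exists>u \<in> Z. \<exists>v \<in> pverts G - Z. (u, v) \<in> parcs G" by blast
qed

lemma conn_insert:
  assumes S: "conn S" and v: "v \<notin> S" "u \<in> S" "(u, v) \<in> parcs G"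
  shows "conn (insert v S)"
  unfolding conn_def
proof (intro conjI allI impI)
  fix Z assume Z: "Z \<subset> insert v S" "Z \<noteq> {}"
  show "\<exists>s \<in> Z. \<exists>t \<in> insert v S - Z. (s, t) \<in> parcs G"
  proof (cases "Z - {v} = {} \<or> Z - {v} = S")
    case True
    then show ?thesis
      using Z v parcs_sym by blast
  next
    case False
    then have "Z - {v} \<subset> S" "Z - {v} \<noteq> {}"
      using Z by auto
    then obtain s t where "s \<in> Z - {v}" "t \<in> S - (Z - {v})" "(s, t) \<in> parcs G"
      using S unfolding conn_def by blast
    then show ?thesis
      using v(1) by blast
  qed
qed simp

lemma conn_radius2:
  assumes "r \<in> S" and "\<And>v. v \<in> S \<Longrightarrow> v = r \<or> (\<exists>n \<in> S. (r, n) \<in> parcs G \<and> (n = v \<or> (n, v) \<in> parcs G))"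
  shows "conn S"
  unfolding conn_def
proof (intro conjI allI impI)
  fix Z assume Z: "Z \<subset> S" "Z \<noteq> {}"
  show "\<exists>s \<in> Z. \<exists>t \<in> S - Z. (s, t) \<in> parcs G"
  proof (cases "r \<in> Z")
    case True
    then obtain v where v: "v \<in> S - Z" "v \<noteq> r"
      using Z by blast
    then obtain n where "n \<in> S" "(r, n) \<in> parcs G" "n = v \<or> (n, v) \<in> parcs G"
      using assms(2)[of v] by blast
    then show ?thesis
      using v True by (cases "n \<in> Z") auto
  next
    case False
    then obtain v where v: "v \<in> Z" "v \<noteq> r" "v \<in> S"
      using Z by blast
    then obtain n where "n \<in> S" "(r, n) \<in> parcs G" "n = v \<or> (n, v) \<in> parcs G"
      using assms(2)[of v] by blast
    then show ?thesis
      using v False parcs_sym[of r n] parcs_sym[of n v] \<open>r \<in> S\<close> by (cases "n \<in> Z") auto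
  qed
qed (use assms in auto)

text \<open>A largest connected proper subset has an arc to some \<open>v\<close> outside it; adding
  \<open>v\<close> keeps it connected, so by maximality this yields all of \<open>S\<close>.\<close>

lemma conn_non_cut:
  assumes S: "conn S" "finite S" "card S \<ge> 2"
  obtains v where "v \<in> S" "conn (S - {v})"
proof -
  obtain r where "r \<in> S"
    using S by (auto simp: conn_def)
  have "{r} \<noteq> S"
    using S(3) by auto
  then have r: "{r} \<subset> S \<and> conn {r}"
    using \<open>r \<in> S\<close> by (auto simp: conn_def)
  obtain Y where Y: "Y \<subset> S" "conn Y" and max: "\<And>Z. Z \<subset> S \<Longrightarrow> conn Z \<Longrightarrow> card Z \<le> card Y"
    using ex_has_greatest_nat[of "\<lambda>Y. Y \<subset> S \<and> conn Y" "{r}" card "card S"] r S(2)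
    by (metis card_mono less_imp_le psubset_card_mono psubset_imp_subset)
  then obtain u v where uv: "u \<in> Y" "v \<in> S - Y" "(u, v) \<in> parcs G"
    using S(1) unfolding conn_def by blast
  then have "conn (insert v Y)"
    using conn_insert Y(2) by blast
  moreover have "card (insert v Y) > card Y"
    using uv Y(1) S(2) finite_subset[of Y S] by auto
  ultimately have "\<not> insert v Y \<subset> S"
    using max[of "insert v Y"] by auto
  then have "S - {v} = Y"
    using uv Y(1) by auto
  with Y(2) uv that show thesis by blast
qed

text \<open>If a non-cut vertex \<open>x\<close> of a minimum connected dominating set has a
  non-neighbour \<open>w\<close> in it, the set consists of \<open>x\<close>, \<open>w\<close> and a
  common neighbour. Otherwise non-cut vertices are adjacent to the whole set, which makes it a
  clique.\<close>

lemma connected_dominating_set_P5_free: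
  assumes "Digraph_Component.connected (with_proj G)" and P5: "\<not> has_induced G (path_pgraph 5)"
  obtains S where "dominating_set G S"
    "card S \<le> 3 \<or> (\<forall>u \<in> S. \<forall>v \<in> S. u \<noteq> v \<longrightarrow> (u, v) \<in> parcs G)"
proof -
  let ?E = "\<lambda>u v. (u, v) \<in> parcs G"
  have "dominating_set G (pverts G) \<and> conn (pverts G)"
    using conn_pverts[OF assms(1)] by (auto simp: dominating_set_def)
  then obtain S where S: "dominating_set G S" "conn S"
    and min: "\<And>T. dominating_set G T \<Longrightarrow> conn T \<Longrightarrow> card S \<le> card T"
    using ex_has_least_nat[of "\<lambda>S. dominating_set G S \<and> conn S" "pverts G" card] by auto
  have S_sub: "S \<subseteq> pverts G" and finS: "finite S"
    using S(1) finite_dominating_set by (auto simp: dominating_set_def)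
  have path: False if "?E a b" "?E b c" "?E c d" "?E d e" "\<not> ?E a c" "\<not> ?E a d" "\<not> ?E a e"
    "\<not> ?E b d" "\<not> ?E b e" "\<not> ?E c e" for a b c d e
    using has_induced_path5[OF pair_graph_axioms that] P5 by blast
  \<comment> \<open>By minimality of \<open>S\<close>, each of its non-cut vertices has a neighbour outside \<open>S\<close> seeing nothing else in \<open>S\<close>.\<close>
  define NC where "NC = {v \<in> S. conn (S - {v})}"
  have own_nbr: "\<exists>p. p \<notin> S \<and> (\<forall>u \<in> S. ?E p u \<longleftrightarrow> u = v)" if v: "v \<in> NC" for v
  proof -
    have conn: "conn (S - {v})" "v \<in> S"
      using v by (auto simp: NC_def)
    have "card (S - {v}) < card S"
      by (rule card_Diff1_less[OF finS conn(2)])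
    then have "\<not> dominating_set G (S - {v})"
      using min[OF _ conn(1)] by auto
    then obtain p where p: "p \<in> pverts G" "p \<notin> S - {v}" "\<And>u. u \<in> S - {v} \<Longrightarrow> \<not> ?E p u"
      using S_sub by (auto simp: dominating_set_def)
    have "p \<noteq> v"
    proof
      assume "p = v"
      have "{v} \<subset> S"
        using conn by (auto simp: conn_def)
      then obtain u where "u \<in> S - {v}" "?E v u"
        using S(2) unfolding conn_def by blast
      then show False
        using p \<open>p = v\<close> by blast
    qed
    then have "p \<notin> S" using p by blast
    then have "\<exists>u \<in> S. ?E p u"
      using S(1) p by (auto simp: dominating_set_def)
    then show ?thesis
      using p \<open>p \<notin> S\<close> by blast
  qed
  \<comment> \<open>Otherwise an arc of \<open>S\<close> leaves the ball of radius two around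
    \<open>a\<close>; prolonged through \<open>a\<close> to its own neighbour \<open>p\<close>, it
    gives an induced path.\<close>
  have near: "v = a \<or> ?E a v \<or> (\<exists>n \<in> S. ?E a n \<and> ?E n v)" if a: "a \<in> NC" and v: "v \<in> S" for a v
  proof (rule ccontr)
    assume contra: "\<not> ?thesis"
    define Z where "Z = {v \<in> S. v = a \<or> ?E a v \<or> (\<exists>n \<in> S. ?E a n \<and> ?E n v)}"
    have "a \<in> S" using a by (simp add: NC_def)
    then have "Z \<subset> S" "Z \<noteq> {}"
      using contra v by (auto simp: Z_def)
    then obtain b w where bw: "b \<in> Z" "w \<in> S - Z" "?E b w"
      using S(2) unfolding conn_def by blast
    have "b \<noteq> a" "\<not> ?E a b"
      using bw \<open>a \<in> S\<close> by (auto simp: Z_def)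
    then obtain n where n: "n \<in> S" "?E a n" "?E n b"
      using bw by (auto simp: Z_def)
    obtain p where p: "p \<notin> S" "\<And>u. u \<in> S \<Longrightarrow> ?E p u \<longleftrightarrow> u = a"
      using own_nbr[OF a] by blast
    show False
    proof (rule path[of p a n b w])
      show "\<not> ?E p n" "\<not> ?E p b" "\<not> ?E p w" "?E p a"
        using p n bw \<open>a \<in> S\<close> no_loops' by (auto simp: Z_def)
      show "\<not> ?E a w" "\<not> ?E n w"
        using bw n by (auto simp: Z_def)
    qed fact+
  qed
  \<comment> \<open>Otherwise \<open>s\<close>, \<open>a\<close>, \<open>n\<close>,
    \<open>b\<close>, \<open>t\<close> with a common neighbour \<open>n\<close> in \<open>S\<close>
    is an induced path.\<close>
  have joined: "?E s t" if ab: "a \<in> NC" "b \<in> NC" "a \<noteq> b" "\<not> ?E a b"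
    and s: "\<And>u. u \<in> S \<Longrightarrow> ?E s u \<longleftrightarrow> u = a" and t: "\<And>u. u \<in> S \<Longrightarrow> ?E t u \<longleftrightarrow> u = b" for a b s t
  proof (rule ccontr)
    assume "\<not> ?E s t"
    have S': "a \<in> S" "b \<in> S"
      using ab by (auto simp: NC_def)
    obtain n where n: "n \<in> S" "?E a n" "?E n b"
      using near[OF ab(1) S'(2)] ab by blast
    then have "n \<noteq> a" "n \<noteq> b"
      using no_loops' by auto
    show False
    proof (rule path[of s a n b t])
      show "?E b t" "\<not> ?E a t" "\<not> ?E n t"
        using t[of b] t[of a] t[of n] S' n ab \<open>n \<noteq> b\<close> parcs_sym by blast+
      show "?E s a" "\<not> ?E s n" "\<not> ?E s b"
        using s S' n ab \<open>n \<noteq> a\<close> by auto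
    qed fact+
  qed
  show thesis
  proof (cases "\<exists>x \<in> NC. \<exists>w \<in> S. w \<noteq> x \<and> \<not> ?E x w")
    case True
    then obtain x w where x: "x \<in> NC" "x \<in> S" and w: "w \<in> S" "w \<noteq> x" "\<not> ?E x w"
      by (auto simp: NC_def)
    \<comment> \<open>Without \<open>c\<close> the rest of \<open>S\<close> is still within two
      steps of \<open>x\<close>: intermediate vertices are adjacent to \<open>x\<close>, hence
      differ from \<open>c\<close>.\<close>
    have far: "c \<in> NC" if c: "c \<in> S" "c \<noteq> x" "\<not> ?E x c" for c
    proof -
      have "conn (S - {c})"
        by (rule conn_radius2[of x]) (use near[OF x(1)] c x in blast)+
      then show ?thesis using c by (simp add: NC_def)
    qed
    have "w \<in> NC" using far w by blast
    obtain m where m: "m \<in> S" "?E x m" "?E m w"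
      using near[OF x(1) w(1)] w by blast
    have "m \<noteq> x" "m \<noteq> w"
      using m no_loops' by auto
    obtain p where p: "\<And>u. u \<in> S \<Longrightarrow> ?E p u \<longleftrightarrow> u = x"
      using own_nbr[OF x(1)] by blast
    obtain r where r: "\<And>u. u \<in> S \<Longrightarrow> ?E r u \<longleftrightarrow> u = w"
      using own_nbr[OF \<open>w \<in> NC\<close>] by blast
    \<comment> \<open>If the own neighbour \<open>s\<close> of \<open>t\<close> is adjacent to
      \<open>r\<close> or \<open>p\<close>, there is an induced path through \<open>x\<close>,
      \<open>m\<close> and \<open>w\<close>; if not, \<open>s\<close>, \<open>t\<close>,
      \<open>x\<close>, \<open>p\<close>, \<open>r\<close> is one.\<close>
    have NC_sub: "t \<in> {x, m, w}" if t: "t \<in> NC" for t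
    proof (rule ccontr)
      assume nt: "t \<notin> {x, m, w}"
      have "t \<in> S" using t by (simp add: NC_def)
      obtain s where s: "\<And>u. u \<in> S \<Longrightarrow> ?E s u \<longleftrightarrow> u = t"
        using own_nbr[OF t] by blast
      have ns: "\<not> ?E s x" "\<not> ?E s m" "\<not> ?E s w" "?E s t"
        using s x w m nt \<open>t \<in> S\<close> by auto
      have "\<not> ?E s r"
      proof
        assume "?E s r"
        show False
          by (rule path[of x m w r s])
            (use m w r[of x] r[of m] r[of w] x ns \<open>?E s r\<close> \<open>m \<noteq> w\<close> parcs_sym in blast)+
      qed
      have "\<not> ?E s p"
      proof
        assume "?E s p"
        show False
          by (rule path[of w m x p s])
            (use m w p[of x] p[of m] p[of w] x ns \<open>?E s p\<close> \<open>m \<noteq> x\<close> parcs_sym in blast)+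
      qed
      have "?E x t"
        using joined[OF t x(1) _ _ s p] \<open>\<not> ?E s p\<close> nt parcs_sym by blast
      have "?E t w"
        using joined[OF t \<open>w \<in> NC\<close> _ _ s r] \<open>\<not> ?E s r\<close> nt parcs_sym by blast
      have "?E p r"
        using joined[OF x(1) \<open>w \<in> NC\<close> _ _ p r] w by blast
      show False
        by (rule path[of s t x p r])
          (use ns \<open>?E x t\<close> \<open>?E p r\<close> p[of x] p[of t] r[of x] r[of t] nt x \<open>t \<in> S\<close> w
            \<open>\<not> ?E s r\<close> \<open>\<not> ?E s p\<close> parcs_sym in blast)+
    qed
    have "S \<subseteq> {x, m, w}"
    proof
      fix t assume "t \<in> S"
      show "t \<in> {x, m, w}"
      proof (rule ccontr)
        assume nt: "t \<notin> {x, m, w}"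
        \<comment> \<open>Deleting the cut vertex \<open>t\<close> separates some \<open>c\<close>
          from \<open>x\<close>. Being non-adjacent to \<open>x\<close>, this \<open>c\<close> is
          non-cut and thus one of \<open>x\<close>, \<open>m\<close>, \<open>w\<close>, which all
          lie on the side of \<open>x\<close>.\<close>
        then have "\<not> conn (S - {t})"
          using NC_sub[of t] \<open>t \<in> S\<close> by (auto simp: NC_def)
        then obtain Z where Z: "Z \<subset> S - {t}" "Z \<noteq> {}" "\<And>u v. u \<in> Z \<Longrightarrow> v \<in> S - {t} - Z \<Longrightarrow> \<not> ?E u v"
          using x nt by (auto simp: conn_def)
        obtain c where c: "c \<in> S - {t}" "c \<in> Z \<longleftrightarrow> x \<notin> Z"
          using Z(1,2) by (cases "x \<in> Z") blast+
        have sep: "\<not> ?E u v" if "u \<in> S - {t}" "v \<in> S - {t}" "u \<in> Z \<longleftrightarrow> v \<notin> Z" for u v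
          using Z(3)[of u v] Z(3)[of v u] that parcs_sym by blast
        have "m \<in> Z \<longleftrightarrow> x \<in> Z" "w \<in> Z \<longleftrightarrow> m \<in> Z"
          using sep[of x m] sep[of m w] m w x nt by auto
        moreover have "c \<in> NC"
          using far[of c] sep[of x c] c x nt by auto
        then have "c \<in> {x, m, w}" by (rule NC_sub)
        ultimately show False
          using c(2) by auto
      qed
    qed
    then have "card S \<le> card {x, m, w}"
      by (rule card_mono[rotated]) simp
    also have "\<dots> \<le> 3"
      by (simp add: card_insert_if)
    finally show thesis
      using that S(1) by blast
  next
    case False
    then have universal: "?E x w" if "x \<in> NC" "w \<in> S" "w \<noteq> x" for x w
      using that by blast
    show thesis
    proof (cases "card S \<ge> 2")
      case True
      then obtain x where x: "x \<in> NC"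
        using conn_non_cut[OF S(2) finS] by (auto simp: NC_def)
      \<comment> \<open>Deleting a vertex other than \<open>x\<close> leaves all remaining ones
        adjacent to \<open>x\<close>.\<close>
      have "v \<in> NC" if v: "v \<in> S" for v
      proof (cases "v = x")
        case False
        have "conn (S - {v})"
          by (rule conn_radius2[of x])
            (use universal[OF x] x v False in \<open>auto simp: NC_def\<close>)
        then show ?thesis using v by (simp add: NC_def)
      qed (use x in simp)
      then have "\<forall>u \<in> S. \<forall>v \<in> S. u \<noteq> v \<longrightarrow> ?E u v"
        using universal by metis
      then show thesis
        by (rule that[OF S(1) disjI2])
    next
      case False
      then have "card S \<le> 3" by simp
      with S(1) show thesis by (blast intro: that)
    qed
  qed
qed

lemma dominating_set_card_less:
  assumes "Digraph_Component.connected (with_proj G)" "\<not> has_induced G (path_pgraph 5)"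
    and "\<not> has_induced G (complete_pgraph r)" "r \<ge> 4"
  shows "\<exists>S. dominating_set G S \<and> card S < r"
proof -
  obtain S where S: "dominating_set G S"
    "card S \<le> 3 \<or> (\<forall>u \<in> S. \<forall>v \<in> S. u \<noteq> v \<longrightarrow> (u, v) \<in> parcs G)"
    using connected_dominating_set_P5_free[OF assms(1,2)] by blast
  have "card S < r"
  proof (rule ccontr)
    assume "\<not> card S < r"
    then obtain A where A: "A \<subseteq> S" "card A = r"
      using obtain_subset_with_card_n[of r S] by auto
    have "has_induced G (complete_pgraph r)"
    proof (rule has_induced_complete[OF pair_graph_axioms _ A(2)])
      show "A \<subseteq> pverts G"
        using A S(1) by (auto simp: dominating_set_def)
    qed (use A S(2) \<open>\<not> card S < r\<close> \<open>r \<ge> 4\<close> in auto)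
    with assms(3) show False ..
  qed
  with S(1) show ?thesis by blast
qed

section \<open>Power and domination number\<close>

lemma domination_power_le_domination_number:
  assumes "pverts G \<noteq> {}"
  shows "domination_power G \<le> domination_number G"
proof -
  obtain D where D: "gamma_set G D"
    using gamma_set_exists by blast
  have "finite {D. gamma_set G D}"
    by (rule finite_subset[OF _ finite_dominating_sets]) (auto simp: gamma_set_def)
  then have "domination_power G \<le> allegiance G D"
    unfolding domination_power_def using D by (intro Min_le) auto
  also have "\<dots> \<le> card D"
  proof -
    have "finite D"
      using D finite_dominating_set by (auto simp: gamma_set_def)
    then show ?thesis
      unfolding allegiance_def using assms by (subst Max_le_iff) (auto intro: card_mono)
  qed
  finally show ?thesis
    using D by (simp add: gamma_set_def)
qed

end

theorem proposition2p4:
  fixes G :: "'a pair_pre_digraph"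
  assumes "pair_graph G"
    and "Digraph_Component.connected (with_proj G)"
  shows "(\<not> has_induced G (complete_pgraph 4) \<and> \<not> has_induced G (path_pgraph 5) \<longrightarrow>
           (\<forall>H :: 'b pair_pre_digraph.
              pair_graph H \<and> Digraph_Component.connected (with_proj H) \<longrightarrow>
              domination_number (cartesian_product G H) \<ge>
                domination_number G * domination_number H)) \<and>
         (\<forall>r :: nat. r > 4 \<and> \<not> has_induced G (complete_pgraph r) \<and>
              \<not> has_induced G (path_pgraph 5) \<longrightarrow>
              domination_power G \<le> r - 1)"
proof -
  interpret pair_graph G by fact
  have nonempty: "pverts G \<noteq> {}"
    using conn_pverts[OF assms(2)] by (simp add: conn_def)
  have less: "domination_number G < r"
    if "r \<ge> 4" "\<not> has_induced G (complete_pgraph r)" "\<not> has_induced G (path_pgraph 5)" for r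
    using dominating_set_card_less[OF assms(2) that(3,2,1)] domination_number_le
    by (meson le_less_trans)
  show ?thesis
  proof (intro conjI allI impI)
    fix H :: "'b pair_pre_digraph"
    assume "\<not> has_induced G (complete_pgraph 4) \<and> \<not> has_induced G (path_pgraph 5)"
      and "pair_graph H \<and> Digraph_Component.connected (with_proj H)"
    then show "domination_number G * domination_number H \<le> domination_number (cartesian_product G H)"
      using less[of 4] nonempty by (intro vizing_domination_number_le_3 assms(1)) auto
  next
    fix r :: nat
    assume "r > 4 \<and> \<not> has_induced G (complete_pgraph r) \<and> \<not> has_induced G (path_pgraph 5)"
    then show "domination_power G \<le> r - 1"
      using less[of r] domination_power_le_domination_number[OF nonempty] by auto
  qed
qed

end
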